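(* Let $\widetilde W$ be an irreducible affine Weyl group with root system $\widetilde\Phi$ and positive system $\widetilde\Phi^+=\Phi^\wedge$. Any hemispace of the oriented matroid $(\widetilde\Phi,-,\mathrm{cone}_{\widetilde\Phi})$ is of the form $N(w)\uplus-(\Phi^\wedge\setminus N(w))$ or $-N(w)\uplus(\Phi^\wedge\setminus N(w))$, where $w\in\widetilde W$ or $w$ is an infinite reduced word of $\widetilde W$.
   Context: Affine root system: $\Phi$ is a finite irreducible crystallographic root system in a Euclidean space $V$, with standard positive system $\Phi^+$, $\Phi^-=-\Phi^+$, simple system $\Delta$ and highest root $\rho$. Put $V'=V\oplus\mathbb R\delta$ and extend the inner product by $(\delta,v)=0$ for all $v\in V'$. For $\alpha\in\Phi^+$ let $\{\alpha\}^\wedge=\{\alpha+n\delta\mid n\in\mathbb Z_{\ge0}\}$; for $\alpha\in\Phi^-$ let $\{\alpha\}^\wedge=\{\alpha+(n+1)\delta\mid n\in\mathbb Z_{\ge0}\}$; for $\Lambda\subset\Phi$ let $\Lambda^\wedge=\bigcup_{\alpha\in\Lambda}\{\alpha\}^\wedge$. Then $\widetilde\Phi=\Phi^\wedge\uplus-\Phi^\wedge$, and $\widetilde W$ is the group generated by the reflections $s_\gamma(v)=v-2\frac{(v,\gamma)}{(\gamma,\gamma)}\gamma$, $\gamma\in\widetilde\Phi$, a Coxeter group with simple reflections those in the simple roots $\Delta\cup\{\delta-\rho\}$. For $w\in\widetilde W$, $N(w)=\{\gamma\in\Phi^\wedge\mid w^{-1}(\gamma)\in-\Phi^\wedge\}$.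 An infinite reduced word is an infinite sequence $w=s_1s_2\cdots$ of simple reflections with every $s_1\cdots s_j$ reduced, and $N(w)=\bigcup_{i\ge1}N(s_1\cdots s_i)$. For $\Gamma\subset\widetilde\Phi$, $\mathrm{cone}(\Gamma)$ is the set of all finite sums $\sum k_iv_i$ with $v_i\in\Gamma\cup\{0\}$, $k_i\in\mathbb R_{\ge0}$, and $\mathrm{cone}_{\widetilde\Phi}(\Gamma)=\mathrm{cone}(\Gamma)\cap\widetilde\Phi$. A subset $F$ is convex if $\mathrm{cone}_{\widetilde\Phi}(F)=F$. A hemispace of $(\widetilde\Phi,-,\mathrm{cone}_{\widetilde\Phi})$ is a convex set $F\subset\widetilde\Phi$ with $F\cap-F=\emptyset$ and $F\cup-F=\widetilde\Phi$. *)

theory Defs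
  imports "HOL-Analysis.Analysis" "HOL-Algebra.Bij" "HOL-Algebra.Generated_Groups"
begin

definition nonneg_cone :: "'b::real_vector set \<Rightarrow> 'b set" where
  "nonneg_cone G = {\<Sum>i<n. k i *\<^sub>R v i | (n::nat) k v. \<forall>i<n. v i \<in> G \<union> {0} \<and> 0 \<le> k i}"

text \<open>A root system is not required to span the ambient space.\<close>

definition crystallographic_root_system :: "'a::euclidean_space set \<Rightarrow> bool" where
  "crystallographic_root_system \<Phi> \<longleftrightarrow>
     finite \<Phi> \<and> 0 \<notin> \<Phi> \<and>
     (\<forall>\<alpha>\<in>\<Phi>. \<Phi> \<inter> span {\<alpha>} = {\<alpha>, - \<alpha>}) \<and>
     (\<forall>\<alpha>\<in>\<Phi>. \<forall>\<beta>\<in>\<Phi>. \<beta> - (2 * (\<beta> \<bullet> \<alpha>) / (\<alpha> \<bullet> \<alpha>)) *\<^sub>R \<alpha> \<in> \<Phi>) \<and>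
     (\<forall>\<alpha>\<in>\<Phi>. \<forall>\<beta>\<in>\<Phi>. 2 * (\<beta> \<bullet> \<alpha>) / (\<alpha> \<bullet> \<alpha>) \<in> \<int>)"

definition irreducible_root_system :: "'a::euclidean_space set \<Rightarrow> bool" where
  "irreducible_root_system \<Phi> \<longleftrightarrow>
     \<Phi> \<noteq> {} \<and>
     \<not> (\<exists>A B. A \<noteq> {} \<and> B \<noteq> {} \<and> A \<inter> B = {} \<and> A \<union> B = \<Phi> \<and> (\<forall>\<alpha>\<in>A. \<forall>\<beta>\<in>B. \<alpha> \<bullet> \<beta> = 0))"

definition simple_system :: "'a::euclidean_space set \<Rightarrow> 'a set \<Rightarrow> bool" where
  "simple_system \<Phi> \<Delta> \<longleftrightarrow>
     \<Delta> \<subseteq> \<Phi> \<and> independent \<Delta> \<and> span \<Delta> = span \<Phi> \<and>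
     (\<forall>\<alpha>\<in>\<Phi>. \<alpha> \<in> nonneg_cone \<Delta> \<or> - \<alpha> \<in> nonneg_cone \<Delta>)"

definition pos_roots :: "'a::euclidean_space set \<Rightarrow> 'a set \<Rightarrow> 'a set" where
  "pos_roots \<Phi> \<Delta> = \<Phi> \<inter> nonneg_cone \<Delta>"

definition highest_root :: "'a::euclidean_space set \<Rightarrow> 'a set \<Rightarrow> 'a \<Rightarrow> bool" where
  "highest_root \<Phi> \<Delta> \<rho> \<longleftrightarrow> \<rho> \<in> \<Phi> \<and> (\<forall>\<alpha>\<in>\<Phi>. \<rho> - \<alpha> \<in> nonneg_cone \<Delta>)"

text \<open>
  The space \<open>V' = V \<oplus> \<real>\<delta>\<close> is the product type, with \<open>(v, c)\<close> standing for \<open>v + c\<delta>\<close>.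
  Its form is the degenerate extension \<open>aff_form\<close> of the inner product of \<open>V\<close>, not the
  inner product of the product type.
\<close>

definition delta :: "'a::euclidean_space \<times> real" where
  "delta = (0, 1)"

definition aff_form :: "'a::euclidean_space \<times> real \<Rightarrow> 'a \<times> real \<Rightarrow> real" where
  "aff_form u v = fst u \<bullet> fst v"

definition aff_reflection ::
    "'a::euclidean_space \<times> real \<Rightarrow> 'a \<times> real \<Rightarrow> 'a \<times> real" where
  "aff_reflection \<gamma> v = v - (2 * (aff_form v \<gamma> / aff_form \<gamma> \<gamma>)) *\<^sub>R \<gamma>"

text \<open>The set \<open>\<Phi>^\<close>: strings \<open>\<alpha> + n\<delta>\<close> start at \<open>n = 0\<close> for positive \<open>\<alpha>\<close>, at \<open>n = 1\<close> for negative \<open>\<alpha>\<close>.\<close>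

definition aff_pos_roots :: "'a::euclidean_space set \<Rightarrow> 'a set \<Rightarrow> ('a \<times> real) set" where
  "aff_pos_roots \<Phi> \<Delta> =
     {(\<alpha>, 0) + real n *\<^sub>R delta | \<alpha> n. \<alpha> \<in> pos_roots \<Phi> \<Delta>} \<union>
     {(\<alpha>, 0) + real (n + 1) *\<^sub>R delta | \<alpha> n. \<alpha> \<in> uminus ` pos_roots \<Phi> \<Delta>}"

definition aff_roots :: "'a::euclidean_space set \<Rightarrow> 'a set \<Rightarrow> ('a \<times> real) set" where
  "aff_roots \<Phi> \<Delta> = aff_pos_roots \<Phi> \<Delta> \<union> uminus ` aff_pos_roots \<Phi> \<Delta>"

definition aff_weyl_group ::
    "'a::euclidean_space set \<Rightarrow> 'a set \<Rightarrow> ('a \<times> real \<Rightarrow> 'a \<times> real) set" where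
  "aff_weyl_group \<Phi> \<Delta> = generate (BijGroup UNIV) (aff_reflection ` aff_roots \<Phi> \<Delta>)"

definition aff_simple_roots :: "'a::euclidean_space set \<Rightarrow> 'a \<Rightarrow> ('a \<times> real) set" where
  "aff_simple_roots \<Delta> \<rho> = (\<lambda>\<alpha>. (\<alpha>, 0)) ` \<Delta> \<union> {delta - (\<rho>, 0)}"

definition aff_simple_reflections ::
    "'a::euclidean_space set \<Rightarrow> 'a \<Rightarrow> ('a \<times> real \<Rightarrow> 'a \<times> real) set" where
  "aff_simple_reflections \<Delta> \<rho> = aff_reflection ` aff_simple_roots \<Delta> \<rho>"

definition word_prod :: "('b \<Rightarrow> 'b) list \<Rightarrow> 'b \<Rightarrow> 'b" where
  "word_prod ss = foldr (\<circ>) ss id"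

definition reduced_word :: "('b \<Rightarrow> 'b) set \<Rightarrow> ('b \<Rightarrow> 'b) list \<Rightarrow> bool" where
  "reduced_word S ss \<longleftrightarrow>
     set ss \<subseteq> S \<and>
     (\<forall>ts. set ts \<subseteq> S \<and> word_prod ts = word_prod ss \<longrightarrow> length ss \<le> length ts)"

text \<open>Infinite words are indexed from \<open>0\<close>: the letter \<open>s\<^sub>i\<close> of \<open>s\<^sub>1s\<^sub>2\<dots>\<close> is \<open>s (i - 1)\<close>.\<close>

definition infinite_reduced_word :: "('b \<Rightarrow> 'b) set \<Rightarrow> (nat \<Rightarrow> 'b \<Rightarrow> 'b) \<Rightarrow> bool" where
  "infinite_reduced_word S s \<longleftrightarrow>
     (\<forall>i. s i \<in> S) \<and> (\<forall>j. reduced_word S (map s [0..<j]))"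

text \<open>
  In the following two definitions \<open>P\<close> is the set of positive roots; \<open>inv_into UNIV w\<close> is the
  inverse map of \<open>w\<close>, whose abbreviation clashes with the group inverse.
\<close>

definition inversion_set :: "'b::uminus set \<Rightarrow> ('b \<Rightarrow> 'b) \<Rightarrow> 'b set" where
  "inversion_set P w = {\<gamma> \<in> P. inv_into UNIV w \<gamma> \<in> uminus ` P}"

definition inversion_set_inf :: "'b::uminus set \<Rightarrow> (nat \<Rightarrow> 'b \<Rightarrow> 'b) \<Rightarrow> 'b set" where
  "inversion_set_inf P s = (\<Union>i\<in>{1..}. inversion_set P (word_prod (map s [0..<i])))"

definition cone_in :: "'b::real_vector set \<Rightarrow> 'b set \<Rightarrow> 'b set" where
  "cone_in E G = nonneg_cone G \<inter> E"

definition convex_in :: "'b::real_vector set \<Rightarrow> 'b set \<Rightarrow> bool" where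
  "convex_in E F \<longleftrightarrow> F \<subseteq> E \<and> cone_in E F = F"

definition hemispace :: "'b::real_vector set \<Rightarrow> 'b set \<Rightarrow> bool" where
  "hemispace E F \<longleftrightarrow> convex_in E F \<and> F \<inter> uminus ` F = {} \<and> F \<union> uminus ` F = E"

definition is_disjoint_union :: "'b set \<Rightarrow> 'b set \<Rightarrow> 'b set \<Rightarrow> bool" where
  "is_disjoint_union F A B \<longleftrightarrow> A \<inter> B = {} \<and> F = A \<union> B"

end

(* Replacing F by -F, assume that delta is not in cone(F), and put B = F \<inter> P for the set P of positive
   affine roots. For each finite subset G of B, separation yields a functional p with p(delta) < 0 that is
   positive on G and negative on P - B; breaking the ties on p = 0 by F gives a hemispace F' with
   G \<subseteq> F' \<inter> P \<subseteq> B and F' \<inter> P finite. A finite positive part F' \<inter> P is an inversion set: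
   as long as N(u) is properly contained in it, u maps some simple root a into F' \<inter> P, and
   N(u s_a) = N(u) \<union> {u(a)}. Extending words in this way so that they absorb an enumeration of B
   produces the infinite reduced word when B is infinite. *)

theory Submission imports Defs begin

section \<open>Cones and hemispaces\<close>

lemma nonneg_cone_0: "0 \<in> nonneg_cone G"
  unfolding nonneg_cone_def by (auto intro!: exI[of _ "0::nat"])

lemma nonneg_cone_step:
  assumes "v \<in> G" "0 \<le> k" "x \<in> nonneg_cone G"
  shows "k *\<^sub>R v + x \<in> nonneg_cone G"
proof -
  obtain n :: nat and c w where cw: "\<forall>i<n. w i \<in> G \<union> {0} \<and> 0 \<le> c i" and x: "x = (\<Sum>i<n. c i *\<^sub>R w i)"
    using assms(3) unfolding nonneg_cone_def by blast
  have "k *\<^sub>R v + x = (\<Sum>i<Suc n. (c(n := k)) i *\<^sub>R (w(n := v)) i)"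
    unfolding x by (simp add: add.commute)
  moreover have "\<forall>i<Suc n. (w(n := v)) i \<in> G \<union> {0} \<and> 0 \<le> (c(n := k)) i"
    using cw assms by (auto simp: less_Suc_eq)
  ultimately show ?thesis
    unfolding nonneg_cone_def mem_Collect_eq
    by (intro exI[of _ "Suc n"] exI[of _ "c(n := k)"] exI[of _ "w(n := v)"] conjI)
qed

text \<open>The partial sums of a representation build the element one generator at a time. Keeping
  each partial sum in the cone makes that membership available in the step; the zero vectors that a
  representation may contain are skipped.\<close>

lemma nonneg_cone_induct [consumes 1, case_names zero step]:
  assumes "x \<in> nonneg_cone G"
    and "Q 0"
    and step: "\<And>v k x. v \<in> G \<Longrightarrow> 0 \<le> k \<Longrightarrow> x \<in> nonneg_cone G \<Longrightarrow> Q x \<Longrightarrow> Q (k *\<^sub>R v + x)"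
  shows "Q x"
proof -
  obtain n :: nat and c w where cw: "\<forall>i<n. w i \<in> G \<union> {0} \<and> 0 \<le> c i" and x: "x = (\<Sum>i<n. c i *\<^sub>R w i)"
    using assms(1) unfolding nonneg_cone_def by blast
  have "m \<le> n \<Longrightarrow> (\<Sum>i<m. c i *\<^sub>R w i) \<in> nonneg_cone G \<and> Q (\<Sum>i<m. c i *\<^sub>R w i)" for m
  proof (induction m)
    case 0
    then show ?case using assms(2) by (simp add: nonneg_cone_0)
  next
    case (Suc m)
    then have *: "(\<Sum>i<m. c i *\<^sub>R w i) \<in> nonneg_cone G" "Q (\<Sum>i<m. c i *\<^sub>R w i)"
      and "w m \<in> G \<union> {0}" "0 \<le> c m"
      using cw by auto
    then show ?case
      using step[OF _ _ *] nonneg_cone_step[OF _ _ *(1)]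
      by (cases "w m \<in> G") (auto simp: add.commute)
  qed
  then show ?thesis using x by auto
qed

lemma nonneg_cone_base: "v \<in> G \<Longrightarrow> v \<in> nonneg_cone G"
  using nonneg_cone_step[of v G 1 0] by (simp add: nonneg_cone_0)

lemma nonneg_cone_add: "x \<in> nonneg_cone G \<Longrightarrow> y \<in> nonneg_cone G \<Longrightarrow> x + y \<in> nonneg_cone G"
  by (induction rule: nonneg_cone_induct) (auto simp: add.assoc intro: nonneg_cone_step)

lemma nonneg_cone_scale: "x \<in> nonneg_cone G \<Longrightarrow> 0 \<le> k \<Longrightarrow> k *\<^sub>R x \<in> nonneg_cone G"
  by (induction rule: nonneg_cone_induct)
    (auto simp: scaleR_add_right nonneg_cone_0 intro: nonneg_cone_step)

lemma nonneg_cone_sum: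
  "(\<And>i. i \<in> I \<Longrightarrow> f i \<in> nonneg_cone G) \<Longrightarrow> sum f I \<in> nonneg_cone G"
  by (induction I rule: infinite_finite_induct) (auto simp: nonneg_cone_0 intro: nonneg_cone_add)

lemma nonneg_cone_least: "x \<in> nonneg_cone G \<Longrightarrow> G \<subseteq> nonneg_cone H \<Longrightarrow> x \<in> nonneg_cone H"
  by (induction rule: nonneg_cone_induct)
    (auto simp: nonneg_cone_0 intro: nonneg_cone_add nonneg_cone_scale)

lemma nonneg_cone_linear_image:
  assumes "linear f" "x \<in> nonneg_cone G"
  shows "f x \<in> nonneg_cone (f ` G)"
  using assms(2)
  by (induction rule: nonneg_cone_induct)
    (auto simp: linear_0[OF assms(1)] linear_add[OF assms(1)] linear_scale[OF assms(1)]
       nonneg_cone_0 intro: nonneg_cone_step)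

lemma nonneg_cone_uminus: "x \<in> nonneg_cone (uminus ` G) \<longleftrightarrow> - x \<in> nonneg_cone G"
proof -
  have "linear (uminus :: 'a \<Rightarrow> 'a)" by (simp add: linear_iff)
  from nonneg_cone_linear_image[OF this, of x "uminus ` G"] nonneg_cone_linear_image[OF this, of "- x" G]
  show ?thesis by (auto simp: image_image)
qed

lemma nonneg_cone_functional:
  fixes f :: "'b::real_vector \<Rightarrow> real"
  assumes "linear f" "\<And>v. v \<in> G \<Longrightarrow> 0 \<le> f v" "x \<in> nonneg_cone G"
  shows "0 \<le> f x"
  using assms(3)
  by (induction rule: nonneg_cone_induct)
    (auto simp: linear_0[OF assms(1)] linear_add[OF assms(1)] linear_scale[OF assms(1)] assms(2))

text \<open>Nonnegative numbers that add up to zero all vanish, so each generator with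
  \<open>f v > 0\<close> enters with coefficient zero.\<close>

lemma nonneg_cone_face:
  fixes f :: "'b::real_vector \<Rightarrow> real"
  assumes f: "linear f" "\<And>v. v \<in> G \<Longrightarrow> 0 \<le> f v" and "x \<in> nonneg_cone G" "f x = 0"
  shows "x \<in> nonneg_cone {v \<in> G. f v = 0}"
  using assms(3,4)
proof (induction rule: nonneg_cone_induct)
  case zero
  show ?case by (rule nonneg_cone_0)
next
  case (step v k x)
  have "0 \<le> f x" "0 \<le> k * f v"
    using nonneg_cone_functional[OF f] step f by auto
  moreover have "k * f v + f x = 0"
    using step.prems by (simp add: linear_add[OF f(1)] linear_scale[OF f(1)])
  ultimately have "f x = 0" "k * f v = 0" by linarith+
  then show ?case
    using step by (cases "k = 0") (auto intro: nonneg_cone_step)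
qed

section \<open>Hemispaces: membership, pointedness, separation, refinement\<close>

lemma hemispaceD:
  assumes "hemispace E F"
  shows "F \<subseteq> E" "uminus ` F \<subseteq> E"
    "\<And>x. x \<in> nonneg_cone F \<Longrightarrow> x \<in> E \<Longrightarrow> x \<in> F"
    "\<And>x. x \<in> F \<Longrightarrow> - x \<notin> F"
    "\<And>x. x \<in> E \<Longrightarrow> x \<notin> F \<Longrightarrow> - x \<in> F"
    "\<And>x. x \<in> E \<Longrightarrow> - x \<in> E"
proof -
  have F: "F \<subseteq> E" "nonneg_cone F \<inter> E = F" "F \<inter> uminus ` F = {}" "F \<union> uminus ` F = E"
    using assms by (auto simp: hemispace_def convex_in_def cone_in_def)
  have mem: "x \<in> uminus ` F \<longleftrightarrow> - x \<in> F" for x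
    by (metis add.inverse_inverse image_iff)
  show "F \<subseteq> E" "uminus ` F \<subseteq> E" using F by blast+
  show "x \<in> F" if "x \<in> nonneg_cone F" "x \<in> E" for x using F(2) that by blast
  show "- x \<notin> F" if "x \<in> F" for x using F(3) that mem[of x] by blast
  show neg: "- x \<in> F" if "x \<in> E" "x \<notin> F" for x using F(4) that mem[of x] by blast
  show "- x \<in> E" if "x \<in> E" for x
    using F(4) that mem[of x] mem[of "- x"] by auto
qed

lemma hemispaceI:
  assumes "F \<subseteq> E" "\<And>x. x \<in> E \<Longrightarrow> - x \<in> E"
    "\<And>x. x \<in> nonneg_cone F \<Longrightarrow> x \<in> E \<Longrightarrow> x \<in> F"
    "\<And>x. x \<in> F \<Longrightarrow> - x \<notin> F"
    "\<And>x. x \<in> E \<Longrightarrow> x \<notin> F \<Longrightarrow> - x \<in> F"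
  shows "hemispace E F"
proof -
  have "F \<union> uminus ` F = E"
  proof (intro equalityI subsetI)
    fix x assume "x \<in> E"
    then show "x \<in> F \<union> uminus ` F"
      using assms(5)[of x] by (metis UnCI add.inverse_inverse image_eqI)
  qed (use assms in auto)
  then show ?thesis
    unfolding hemispace_def convex_in_def cone_in_def
    using assms(1,3,4) nonneg_cone_base by blast
qed

lemma hemispace_uminus:
  assumes "hemispace E F"
  shows "hemispace E (uminus ` F)"
proof -
  note D = hemispaceD[OF assms]
  have mem: "x \<in> uminus ` F \<longleftrightarrow> - x \<in> F" for x :: 'a
    by (metis add.inverse_inverse image_iff)
  show ?thesis
  proof (rule hemispaceI)
    show "uminus ` F \<subseteq> E" "\<And>x. x \<in> E \<Longrightarrow> - x \<in> E"
      using D by blast+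
    fix x
    show "x \<in> nonneg_cone (uminus ` F) \<Longrightarrow> x \<in> E \<Longrightarrow> x \<in> uminus ` F"
      using D(3,6) by (simp add: mem nonneg_cone_uminus)
    show "x \<in> uminus ` F \<Longrightarrow> - x \<notin> uminus ` F"
      using D(4)[of "- x"] by (simp add: mem)
    show "x \<in> E \<Longrightarrow> x \<notin> uminus ` F \<Longrightarrow> - x \<in> uminus ` F"
      using D(5)[of "- x"] D(6)[of x] by (simp add: mem)
  qed
qed

lemma hemispace_neg_notin_cone:
  assumes "hemispace E F" "x \<in> F"
  shows "- x \<notin> nonneg_cone F"
  using hemispaceD[OF assms(1)] assms(2) by blast

text \<open>Convexity in \<open>E\<close> constrains roots only; this extends it to all vectors of
  the cone, in particular to \<open>delta\<close>, which is not a root. If a combination and its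
  negative both lie in the cone, cancelling all but one summand with a positive coefficient leaves
  the negative of a generator in the cone.\<close>

lemma hemispace_pointed:
  assumes "hemispace E F" "x \<in> nonneg_cone F" "- x \<in> nonneg_cone F"
  shows "x = 0"
  using assms(2,3)
proof (induction rule: nonneg_cone_induct)
  case (step v k x)
  have kv: "k = 0"
  proof (rule ccontr)
    assume "k \<noteq> 0"
    then have "- v = (1 / k) *\<^sub>R (x + - (k *\<^sub>R v + x))" by simp
    also have "\<dots> \<in> nonneg_cone F"
      using step by (intro nonneg_cone_scale nonneg_cone_add) auto
    finally show False using hemispace_neg_notin_cone[OF assms(1)] step by blast
  qed
  then show ?case using step by simp
qed simp

text \<open>In a vanishing convex combination some coefficient is positive; solving for its vector
  puts the negative of an element of \<open>F\<close> into the cone.\<close>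

lemma hemispace_zero_notin_hull:
  assumes "hemispace E F"
  shows "0 \<notin> convex hull F"
proof
  assume "0 \<in> convex hull F"
  then obtain I u where I: "finite I" "I \<subseteq> F" and u: "\<forall>x\<in>I. 0 \<le> u x" "sum u I = (1::real)"
    "(\<Sum>x\<in>I. u x *\<^sub>R x) = 0"
    unfolding convex_hull_explicit by blast
  then obtain x where x: "x \<in> I" "u x > 0"
    by (metis less_eq_real_def sum.neutral zero_neq_one)
  have "u x *\<^sub>R x + (\<Sum>y\<in>I - {x}. u y *\<^sub>R y) = 0"
    using u(3) I(1) x(1) by (simp add: sum.remove)
  then have "(\<Sum>y\<in>I - {x}. u y *\<^sub>R y) = - (u x *\<^sub>R x)"
    by (simp add: add_eq_0_iff)
  then have "- x = (1 / u x) *\<^sub>R (\<Sum>y\<in>I - {x}. u y *\<^sub>R y)"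
    using x(2) by simp
  also have "\<dots> \<in> nonneg_cone F"
    using I u x by (intro nonneg_cone_scale nonneg_cone_sum) (auto intro: nonneg_cone_base)
  finally show False using hemispace_neg_notin_cone[OF assms] x I by blast
qed

lemma convex_hull_subset_nonneg_cone: "convex hull G \<subseteq> nonneg_cone G"
proof
  fix x assume "x \<in> convex hull G"
  then obtain I u where "I \<subseteq> G" "\<forall>y\<in>I. 0 \<le> u y" "(\<Sum>y\<in>I. u y *\<^sub>R y) = x"
    unfolding convex_hull_explicit by blast
  then show "x \<in> nonneg_cone G"
    by (auto intro!: nonneg_cone_sum intro: nonneg_cone_scale nonneg_cone_base)
qed

text \<open>The hull of \<open>A\<close> and \<open>- d\<close> misses the origin, so a hyperplane
  separates the two strictly. Finiteness of \<open>A\<close> makes the hull compact, hence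
  closed.\<close>

lemma hemispace_separation:
  fixes E F A :: "'b::euclidean_space set"
  assumes "hemispace E F" "d \<notin> nonneg_cone F" "finite A" "A \<subseteq> F"
  shows "\<exists>p. p \<bullet> d < 0 \<and> (\<forall>x\<in>A. 0 < p \<bullet> x)"
proof -
  have "0 \<notin> convex hull (insert (- d) A)"
  proof (cases "A = {}")
    case True
    then show ?thesis using assms(2) by (auto simp: nonneg_cone_0)
  next
    case False
    show ?thesis
    proof
      assume "0 \<in> convex hull (insert (- d) A)"
      then obtain u v b where uv: "0 \<le> u" "0 \<le> v" "u + v = 1" and b: "b \<in> convex hull A"
        and eq: "0 = u *\<^sub>R (- d) + v *\<^sub>R b"
        unfolding convex_hull_insert[OF False] by auto
      have bF: "b \<in> convex hull F" using b assms(4) hull_mono by blast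
      \<comment> \<open>\<open>u\<close> is the weight of \<open>- d\<close>. If it is zero, the
        origin lies in the hull of \<open>F\<close>; otherwise solving for \<open>d\<close> puts
        \<open>d\<close> into the cone.\<close>
      show False
      proof (cases "u = 0")
        case True
        then show False using uv eq bF hemispace_zero_notin_hull[OF assms(1)] by auto
      next
        case False
        then have "d = (1 / u) *\<^sub>R (u *\<^sub>R d)" by simp
        also have "u *\<^sub>R d = v *\<^sub>R b" using eq by simp
        finally have "d = (v / u) *\<^sub>R b" by simp
        also have "\<dots> \<in> nonneg_cone F"
          using uv bF convex_hull_subset_nonneg_cone by (intro nonneg_cone_scale) auto
        finally show False using assms(2) by simp
      qed
    qed
  qed
  moreover have "closed (convex hull (insert (- d) A))"
    using assms(3) by (intro compact_imp_closed finite_imp_compact_convex_hull) auto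
  ultimately obtain p b where "0 < b" "\<forall>x\<in>convex hull (insert (- d) A). inner p x > b"
    using separating_hyperplane_closed_0[of "convex hull (insert (- d) A)"] by auto
  then have "0 < p \<bullet> x" if "x \<in> insert (- d) A" for x
    using hull_inc[OF that, of convex] by force
  from this[of "- d"] this show ?thesis by (intro exI[of _ p]) auto
qed

text \<open>The choice is lexicographic: the sign of \<open>f\<close> decides first, and
  \<open>F\<close> decides on the kernel. A cone element with \<open>f x = 0\<close> lies in the
  cone of the generators in the kernel, all of them from \<open>F\<close>, so convexity of
  \<open>F\<close> applies to it.\<close>

lemma hemispace_refine:
  assumes F: "hemispace E F" and f: "linear (f :: 'b::real_vector \<Rightarrow> real)"
  shows "hemispace E {x \<in> E. 0 < f x \<or> f x = 0 \<and> x \<in> F}"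
proof (rule hemispaceI)
  let ?F' = "{x \<in> E. 0 < f x \<or> f x = 0 \<and> x \<in> F}"
  fix x assume x: "x \<in> nonneg_cone ?F'" "x \<in> E"
  have pos: "0 \<le> f v" if "v \<in> ?F'" for v using that by auto
  have "0 \<le> f x" using nonneg_cone_functional[OF f pos x(1)] .
  moreover have "x \<in> F" if "f x = 0"
  proof -
    have "x \<in> nonneg_cone {v \<in> ?F'. f v = 0}"
      using nonneg_cone_face[OF f pos x(1) that] .
    then have "x \<in> nonneg_cone F"
      by (rule nonneg_cone_least) (auto intro: nonneg_cone_base)
    then show ?thesis using hemispaceD(3)[OF F] x by blast
  qed
  ultimately show "x \<in> ?F'" using x by auto
next
  fix x assume "x \<in> E" "x \<notin> {x \<in> E. 0 < f x \<or> f x = 0 \<and> x \<in> F}"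
  then show "- x \<in> {x \<in> E. 0 < f x \<or> f x = 0 \<and> x \<in> F}"
    using hemispaceD(5,6)[OF F, of x] by (auto simp: linear_neg[OF f])
qed (use hemispaceD(4,6)[OF F] in \<open>auto simp: linear_neg[OF f]\<close>)


section \<open>Words in simple reflections\<close>

lemma word_prod_Nil [simp]: "word_prod [] = id"
  by (simp add: word_prod_def)

lemma word_prod_append [simp]: "word_prod (xs @ ys) = word_prod xs \<circ> word_prod ys"
  by (induction xs) (auto simp: word_prod_def)

lemma word_prod_Cons [simp]: "word_prod (f # xs) = f \<circ> word_prod xs"
  by (simp add: word_prod_def)

text \<open>A shorter word for the prefix, followed by the old suffix, would shorten the whole
  word.\<close>

lemma reduced_word_prefix:
  assumes "reduced_word R (xs @ ys)"
  shows "reduced_word R xs"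
  unfolding reduced_word_def
proof (intro conjI allI impI)
  fix ts assume "set ts \<subseteq> R \<and> word_prod ts = word_prod xs"
  then have "set (ts @ ys) \<subseteq> R \<and> word_prod (ts @ ys) = word_prod (xs @ ys)"
    using assms by (auto simp: reduced_word_def)
  then have "length (xs @ ys) \<le> length (ts @ ys)"
    using assms unfolding reduced_word_def by blast
  then show "length xs \<le> length ts" by simp
qed (use assms in \<open>auto simp: reduced_word_def\<close>)

text \<open>Isolates the linear facts about roots \<open>E\<close>, positive roots \<open>P\<close>,
  simple roots \<open>S\<close> and reflections \<open>r\<close> on which the arguments about words
  rest. Disjointness of \<open>P\<close> from its negative is derived from independence of
  \<open>S\<close>.\<close>

locale root_basis =
  fixes E P S :: "'b::real_vector set" and r :: "'b \<Rightarrow> 'b \<Rightarrow> 'b"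
  assumes roots: "E = P \<union> uminus ` P"
    and zero: "0 \<notin> E"
    and simple_pos: "S \<subseteq> P"
    and pos_cone: "P \<subseteq> nonneg_cone S"
    and indep: "independent S"
    and line: "\<And>a. a \<in> S \<Longrightarrow> E \<inter> span {a} = {a, - a}"
    and refl_linear: "\<And>a. a \<in> S \<Longrightarrow> linear (r a)"
    and refl_invol: "\<And>a v. a \<in> S \<Longrightarrow> r a (r a v) = v"
    and refl_self: "\<And>a. a \<in> S \<Longrightarrow> r a a = - a"
    and refl_diff: "\<And>a v. a \<in> S \<Longrightarrow> v - r a v \<in> span {a}"
    and refl_root: "\<And>a v. a \<in> S \<Longrightarrow> v \<in> E \<Longrightarrow> r a v \<in> E"
begin

lemma neg_root: "x \<in> E \<Longrightarrow> x \<notin> P \<Longrightarrow> - x \<in> P"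
  by (auto simp: roots)

lemma mem_uminus: "x \<in> uminus ` A \<longleftrightarrow> - x \<in> A" for x :: 'b
  by (metis add.inverse_inverse image_iff)

text \<open>A functional equal to 1 on all simple roots is nonnegative on positive roots. At a root
  that is positive together with its negative it vanishes, and the corresponding face of the cone is
  just 0.\<close>

lemma not_pos_neg: "x \<in> P \<Longrightarrow> - x \<notin> P"
proof
  assume x: "x \<in> P" "- x \<in> P"
  obtain f where f: "linear f" "\<forall>v\<in>S. f v = (1::real)"
    using linear_independent_extend[OF indep, of "\<lambda>_. 1"] by auto
  have pos: "\<And>v. v \<in> S \<Longrightarrow> 0 \<le> f v" using f by auto
  have "0 \<le> f x" "0 \<le> f (- x)"
    using nonneg_cone_functional[OF f(1) pos] x pos_cone by blast+
  then have "f x = 0" using linear_neg[OF f(1)] by auto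
  then have "x \<in> nonneg_cone {v \<in> S. f v = 0}"
    using nonneg_cone_face[OF f(1) pos] x pos_cone by blast
  moreover have "{v \<in> S. f v = 0} = {}" using f by auto
  ultimately have "x \<in> nonneg_cone {}" by simp
  then have "x = 0"
    by (induction rule: nonneg_cone_induct) auto
  then show False using x zero roots by blast
qed

text \<open>A functional that is 0 at \<open>a\<close> and 1 on the other simple roots is invariant
  under \<open>r a\<close>. If \<open>x\<close> and \<open>- r a x\<close> were both positive, it
  would vanish at \<open>x\<close>, making \<open>x\<close> a multiple of \<open>a\<close> and hence
  \<open>a\<close> itself.\<close>

lemma simple_reflection_pos:
  assumes a: "a \<in> S" and x: "x \<in> P" "x \<noteq> a"
  shows "r a x \<in> P"
proof (rule ccontr)
  assume "r a x \<notin> P"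
  moreover have "r a x \<in> E" using refl_root[OF a] x roots by blast
  ultimately have neg: "- r a x \<in> P" by (rule neg_root[rotated])
  obtain f where f: "linear f" "\<forall>v\<in>S. f v = (if v = a then 0 else 1::real)"
    using linear_independent_extend[OF indep, of "\<lambda>v. if v = a then 0 else 1"] by auto
  have pos: "\<And>v. v \<in> S \<Longrightarrow> 0 \<le> f v" using f by auto
  have nn: "0 \<le> f x" "0 \<le> f (- r a x)"
    using nonneg_cone_functional[OF f(1) pos] x neg pos_cone by blast+
  obtain k where k: "x - r a x = k *\<^sub>R a"
    using refl_diff[OF a, of x] by (auto simp: span_singleton)
  have "f x + f (- r a x) = f (k *\<^sub>R a)"
    unfolding k[symmetric] by (simp add: linear_diff[OF f(1)] linear_neg[OF f(1)])
  also have "\<dots> = 0" using f a by (simp add: linear_scale[OF f(1)])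
  finally have "f x = 0" using nn by linarith
  then have "x \<in> nonneg_cone {v \<in> S. f v = 0}"
    using nonneg_cone_face[OF f(1) pos] x pos_cone by blast
  moreover have "{v \<in> S. f v = 0} \<subseteq> {a}" using f by (auto split: if_splits)
  ultimately have "x \<in> nonneg_cone {a}"
    by (meson nonneg_cone_base nonneg_cone_least subsetD subsetI)
  then have "x \<in> span {a}"
    by (induction rule: nonneg_cone_induct) (auto simp: span_zero span_add span_scale span_base)
  then have "x \<in> {a, - a}" using line[OF a] x roots by blast
  then show False using x a simple_pos not_pos_neg by blast
qed

lemma word_linear: "set xs \<subseteq> r ` S \<Longrightarrow> linear (word_prod xs)"
proof (induction xs rule: rev_induct)
  case (snoc f xs)
  then show ?case using refl_linear by (auto intro: linear_compose simp del: comp_apply)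
qed (auto simp: linear_id)

lemma word_root: "set xs \<subseteq> r ` S \<Longrightarrow> v \<in> E \<Longrightarrow> word_prod xs v \<in> E"
proof (induction xs arbitrary: v rule: rev_induct)
  case (snoc f xs)
  then show ?case using refl_root by auto
qed auto

lemma word_rev: "set xs \<subseteq> r ` S \<Longrightarrow> word_prod (rev xs) (word_prod xs v) = v"
proof (induction xs arbitrary: v rule: rev_induct)
  case (snoc f xs)
  then show ?case using refl_invol by auto
qed auto

lemma word_rev': "set xs \<subseteq> r ` S \<Longrightarrow> word_prod xs (word_prod (rev xs) v) = v"
  using word_rev[of "rev xs"] by simp

lemma inv_word: "set xs \<subseteq> r ` S \<Longrightarrow> inv_into UNIV (word_prod xs) = word_prod (rev xs)"
  by (rule inv_equality) (auto simp: word_rev word_rev')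

section \<open>Inversion sets and word length\<close>

definition inversions :: "('b \<Rightarrow> 'b) list \<Rightarrow> 'b set" where
  "inversions xs = inversion_set P (word_prod xs)"

lemma inversions_iff:
  assumes "set xs \<subseteq> r ` S"
  shows "x \<in> inversions xs \<longleftrightarrow> x \<in> P \<and> - word_prod (rev xs) x \<in> P"
  by (simp add: inversions_def inversion_set_def inv_word[OF assms] mem_uminus)

lemma inversions_Nil: "inversions [] = {}"
  using not_pos_neg by (subst set_eq_iff, subst inversions_iff) auto

text \<open>Among the positive roots, \<open>r a\<close> makes only \<open>a\<close> negative, so
  the image of \<open>a\<close> under \<open>word_prod xs\<close> is the only possible new
  inversion.\<close>

lemma inversions_snoc_subset:
  assumes xs: "set xs \<subseteq> r ` S" and a: "a \<in> S"
  shows "inversions (xs @ [r a]) \<subseteq> insert (word_prod xs a) (inversions xs)"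
proof
  fix x assume "x \<in> inversions (xs @ [r a])"
  then have x: "x \<in> P" "- r a (word_prod (rev xs) x) \<in> P"
    using xs a by (simp_all add: inversions_iff)
  let ?y = "word_prod (rev xs) x"
  show "x \<in> insert (word_prod xs a) (inversions xs)"
  proof (cases "?y = a")
    case True
    then show ?thesis using word_rev'[OF xs, of x] by simp
  next
    case False
    have "?y \<notin> P"
      using simple_reflection_pos[OF a _ False] not_pos_neg x by blast
    moreover have "?y \<in> E" using word_root[of "rev xs" x] xs x roots by auto
    ultimately show ?thesis
      using neg_root x xs by (simp add: inversions_iff)
  qed
qed

lemma inversions_snoc:
  assumes xs: "set xs \<subseteq> r ` S" and a: "a \<in> S" and pos: "word_prod xs a \<in> P"
  shows "inversions (xs @ [r a]) = insert (word_prod xs a) (inversions xs)"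
    "word_prod xs a \<notin> inversions xs"
proof -
  have aP: "a \<in> P" using a simple_pos by blast
  show "word_prod xs a \<notin> inversions xs"
    using not_pos_neg[OF aP] xs by (simp add: inversions_iff word_rev)
  have "word_prod xs a \<in> inversions (xs @ [r a])"
    using xs a pos aP by (simp add: inversions_iff word_rev refl_self)
  moreover have "inversions xs \<subseteq> inversions (xs @ [r a])"
  proof
    fix x assume x: "x \<in> inversions xs"
    let ?y = "word_prod (rev xs) x"
    \<comment> \<open>The last letter could remove an old inversion \<open>x\<close> only if
      \<open>- ?y\<close> were \<open>a\<close>; but then \<open>word_prod xs a\<close> would be the
      negative root \<open>- x\<close>.\<close>
    have "- ?y \<noteq> a"
    proof
      assume "- ?y = a"
      then have "word_prod xs a = - x"
        using word_rev'[OF xs, of x] by (simp add: linear_neg[OF word_linear[OF xs]] flip: \<open>- ?y = a\<close>)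
      then show False using pos x not_pos_neg xs by (auto simp: inversions_iff)
    qed
    then have "r a (- ?y) \<in> P"
      using simple_reflection_pos[OF a] x xs by (auto simp: inversions_iff)
    then show "x \<in> inversions (xs @ [r a])"
      using x xs a by (simp add: inversions_iff linear_neg[OF refl_linear])
  qed
  ultimately show "inversions (xs @ [r a]) = insert (word_prod xs a) (inversions xs)"
    using inversions_snoc_subset[OF xs a] by blast
qed

lemma card_inversions_le:
  "set xs \<subseteq> r ` S \<Longrightarrow> finite (inversions xs) \<and> card (inversions xs) \<le> length xs"
proof (induction xs rule: rev_induct)
  case (snoc f xs)
  then obtain a where a: "a \<in> S" "f = r a" by auto
  have xs: "set xs \<subseteq> r ` S" using snoc by auto
  have sub: "inversions (xs @ [f]) \<subseteq> insert (word_prod xs a) (inversions xs)"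
    using inversions_snoc_subset[OF xs a(1)] a by simp
  have fin: "finite (insert (word_prod xs a) (inversions xs))" using snoc xs by simp
  have "card (inversions (xs @ [f])) \<le> card (insert (word_prod xs a) (inversions xs))"
    by (rule card_mono[OF fin sub])
  also have "\<dots> \<le> Suc (card (inversions xs))"
    by (simp add: card_insert_le_m1 card_insert_if snoc xs)
  finally show ?case using snoc xs finite_subset[OF sub fin] by auto
qed (simp add: inversions_Nil)

text \<open>Inversions depend only on the product of a word, and each letter adds at most one. Their
  number is thus a lower bound for the length of every word with the same product.\<close>

lemma reduced_if_card:
  assumes "set xs \<subseteq> r ` S" "card (inversions xs) = length xs"
  shows "reduced_word (r ` S) xs"
  unfolding reduced_word_def
proof (intro conjI allI impI)
  fix ts assume "set ts \<subseteq> r ` S \<and> word_prod ts = word_prod xs"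
  then show "length xs \<le> length ts"
    using card_inversions_le[of ts] assms by (simp add: inversions_def)
qed (rule assms)

section \<open>Words whose inversions exhaust a given set of roots\<close>

text \<open>The equation of cardinality and length guarantees reducedness. The last clause covers
  every prefix because the inversions of an infinite word are collected over all its finite
  prefixes, not only over those reached at the end of a construction stage.\<close>

definition filtration :: "'b set \<Rightarrow> ('b \<Rightarrow> 'b) list \<Rightarrow> bool" where
  "filtration B xs \<longleftrightarrow> set xs \<subseteq> r ` S \<and> card (inversions xs) = length xs \<and>
     (\<forall>j. inversions (take j xs) \<subseteq> B)"

lemma filtration_inversions: "filtration B xs \<Longrightarrow> inversions xs \<subseteq> B"
  unfolding filtration_def by (metis order_refl take_all)

lemma filtration_Nil: "filtration B []"
  by (simp add: filtration_def inversions_Nil)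

lemma filtration_snoc:
  assumes "filtration B xs" "a \<in> S" "word_prod xs a \<in> B \<inter> P"
  shows "filtration B (xs @ [r a])"
proof -
  have xs: "set xs \<subseteq> r ` S" and card: "card (inversions xs) = length xs"
    and sub: "\<And>j. inversions (take j xs) \<subseteq> B"
    using assms by (auto simp: filtration_def)
  have *: "inversions (xs @ [r a]) = insert (word_prod xs a) (inversions xs)"
    "word_prod xs a \<notin> inversions xs"
    using inversions_snoc[OF xs] assms by auto
  have "inversions (take j (xs @ [r a])) \<subseteq> B" for j
  proof (cases "j \<le> length xs")
    case True
    then show ?thesis using sub by simp
  next
    case False
    then have "take j (xs @ [r a]) = xs @ [r a]" by simp
    then show ?thesis using * assms filtration_inversions by auto
  qed
  moreover have "card (inversions (xs @ [r a])) = length (xs @ [r a])"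
    using * card card_inversions_le[OF xs] by simp
  ultimately show ?thesis
    using xs assms(2) by (simp add: filtration_def)
qed

text \<open>If no simple root could be appended, \<open>word_prod xs\<close> would map all simple roots, hence
  \<open>P\<close>, into \<open>- F\<close>.\<close>

lemma hemispace_simple_step:
  assumes F: "hemispace E F" and xs: "set xs \<subseteq> r ` S"
    and sub: "inversions xs \<subset> F \<inter> P"
  obtains a where "a \<in> S" "word_prod xs a \<in> F \<inter> P"
proof (rule ccontr)
  assume "\<not> thesis"
  then have no: "\<And>a. a \<in> S \<Longrightarrow> word_prod xs a \<notin> F \<inter> P" using that by blast
  note D = hemispaceD[OF hemispace_uminus[OF F]]
  have "word_prod xs a \<in> uminus ` F" if a: "a \<in> S" for a
  proof -
    have aE: "word_prod xs a \<in> E"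
      using word_root[OF xs, of a] a simple_pos roots by blast
    show ?thesis
    proof (cases "word_prod xs a \<in> P")
      case True
      then have "word_prod xs a \<notin> F" using no[OF a] by blast
      then show ?thesis using hemispaceD(5)[OF F] aE by (auto simp: mem_uminus)
    next
      case False
      then have "- word_prod xs a \<in> P" using aE neg_root by blast
      \<comment> \<open>The inverse of \<open>word_prod xs\<close> sends this positive root to
        \<open>- a\<close>, so it is an inversion and lies in \<open>F\<close>.\<close>
      then have "- word_prod xs a \<in> inversions xs"
        using xs a simple_pos
        by (auto simp: inversions_iff word_rev linear_neg[OF word_linear])
      then show ?thesis using sub by (auto simp: mem_uminus)
    qed
  qed
  then have image: "word_prod xs ` S \<subseteq> uminus ` F" by blast
  obtain x where x: "x \<in> F" "x \<in> P" "x \<notin> inversions xs" using sub by blast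
  let ?y = "word_prod (rev xs) x"
  have xE: "x \<in> E" using x roots by blast
  have "?y \<in> E" using word_root[of "rev xs" x] xs xE by simp
  then have "?y \<in> P" using x xs neg_root by (auto simp: inversions_iff)
  then have "word_prod xs ?y \<in> nonneg_cone (word_prod xs ` S)"
    using nonneg_cone_linear_image[OF word_linear[OF xs]] pos_cone by blast
  then have "x \<in> nonneg_cone (uminus ` F)"
    using image by (simp add: word_rev'[OF xs]) (meson nonneg_cone_base nonneg_cone_least subsetD subsetI)
  then have "x \<in> uminus ` F" using D(3) xE by blast
  then show False using x(1) hemispaceD(4)[OF F] by (auto simp: mem_uminus)
qed

text \<open>Each use of \<open>hemispace_simple_step\<close> adds one missing root, so the finite
  difference shrinks until nothing is missing. \<open>B\<close> may exceed the positive part of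
  \<open>F\<close>, which lets stages with different hemispaces extend one and the same
  word.\<close>

lemma finite_hemispace_extend:
  assumes F: "hemispace E F" and fin: "finite (F \<inter> P)" and B: "F \<inter> P \<subseteq> B"
    and "filtration B xs" "inversions xs \<subseteq> F \<inter> P"
  shows "\<exists>ys. filtration B (xs @ ys) \<and> inversions (xs @ ys) = F \<inter> P"
  using assms(4,5)
proof (induction "card (F \<inter> P - inversions xs)" arbitrary: xs rule: less_induct)
  case less
  have xs: "set xs \<subseteq> r ` S" using less by (auto simp: filtration_def)
  show ?case
  proof (cases "inversions xs = F \<inter> P")
    case True
    then show ?thesis using less by (intro exI[of _ "[]"]) simp
  next
    case False
    then obtain a where a: "a \<in> S" "word_prod xs a \<in> F \<inter> P"
      using hemispace_simple_step[OF F xs] less by blast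
    have *: "inversions (xs @ [r a]) = insert (word_prod xs a) (inversions xs)"
      "word_prod xs a \<notin> inversions xs"
      using inversions_snoc[OF xs] a by auto
    have "card (F \<inter> P - inversions (xs @ [r a])) < card (F \<inter> P - inversions xs)"
      by (rule psubset_card_mono) (use fin * a in auto)
    moreover have "filtration B (xs @ [r a])"
      using filtration_snoc less a B by blast
    ultimately obtain ys where "filtration B ((xs @ [r a]) @ ys)"
      "inversions ((xs @ [r a]) @ ys) = F \<inter> P"
      using less.hyps[of "xs @ [r a]"] less.prems a * by auto
    then show ?thesis by (intro exI[of _ "[r a] @ ys"]) simp
  qed
qed

lemma infinite_word:
  assumes inf: "infinite B" "countable B" "B \<subseteq> P"
    and approx: "\<And>G. finite G \<Longrightarrow> G \<subseteq> B \<Longrightarrow>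
      \<exists>F. hemispace E F \<and> finite (F \<inter> P) \<and> G \<subseteq> F \<and> F \<inter> P \<subseteq> B"
  shows "\<exists>s. infinite_reduced_word (r ` S) s \<and> B = inversion_set_inf P s"
proof -
  define b where "b = from_nat_into B"
  have b: "bij_betw b UNIV B"
    unfolding b_def using inf by (intro bij_betw_from_nat_into)
  then have bB: "\<And>k. b k \<in> B" by (auto simp: bij_betw_def)
  have "\<exists>ws. \<forall>k. filtration B (ws k) \<and>
      (\<exists>ys. ws (Suc k) = ws k @ ys) \<and> inversions (ws k) \<subseteq> inversions (ws (Suc k)) \<and>
      b k \<in> inversions (ws (Suc k))"
  proof (rule dependent_nat_choice)
    show "\<exists>xs. filtration B xs" using filtration_Nil by blast
    fix xs k assume xs: "filtration B xs"
    then have xsS: "set xs \<subseteq> r ` S" by (simp add: filtration_def)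
    have G: "finite (insert (b k) (inversions xs))" "insert (b k) (inversions xs) \<subseteq> B"
      using card_inversions_le[OF xsS] filtration_inversions[OF xs] bB by auto
    \<comment> \<open>Besides \<open>b k\<close>, the hemispace has to contain the inversions found
      so far, so that the current word is extended and not replaced.\<close>
    obtain F where F: "hemispace E F" "finite (F \<inter> P)" "insert (b k) (inversions xs) \<subseteq> F"
      "F \<inter> P \<subseteq> B"
      using approx[OF G] by blast
    have "inversions xs \<subseteq> F \<inter> P" using F filtration_inversions[OF xs] inf by blast
    then obtain ys where "filtration B (xs @ ys)" "inversions (xs @ ys) = F \<inter> P"
      using finite_hemispace_extend[OF F(1,2,4) xs] by blast
    moreover have "b k \<in> F \<inter> P" using F bB inf by blast
    ultimately show "\<exists>zs. filtration B zs \<and> (\<exists>ys. zs = xs @ ys) \<and>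
        inversions xs \<subseteq> inversions zs \<and> b k \<in> inversions zs"
      using \<open>inversions xs \<subseteq> F \<inter> P\<close> by blast
  qed
  then obtain ws where ws: "\<And>k. filtration B (ws k)" "\<And>k. \<exists>ys. ws (Suc k) = ws k @ ys"
    "\<And>k. inversions (ws k) \<subseteq> inversions (ws (Suc k))" "\<And>k. b k \<in> inversions (ws (Suc k))"
    by blast
  have mono: "\<exists>ys. ws l = ws k @ ys" if "k \<le> l" for k l
    using that
  proof (induction rule: dec_induct)
    case (step n)
    then show ?case using ws(2)[of n] by force
  qed simp
  have set_ws: "set (ws k) \<subseteq> r ` S" for k using ws(1) by (auto simp: filtration_def)
  \<comment> \<open>The words are nested, so letter \<open>i\<close> can be read off in any of them
    that is long enough; \<open>ws (Suc i)\<close> is, by \<open>long\<close> below.\<close>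
  define s where "s i = ws (Suc i) ! i" for i
  have reduced: "reduced_word (r ` S) (ws k)" for k
    using ws(1)[of k] by (intro reduced_if_card) (auto simp: filtration_def)
  have long: "k \<le> length (ws k)" for k
  proof -
    \<comment> \<open>The first \<open>k\<close> roots of the enumeration are distinct inversions of
      \<open>ws k\<close>, and the number of inversions of \<open>ws k\<close> is its
      length.\<close>
    have "b ` {..<k} \<subseteq> inversions (ws k)"
    proof
      fix x assume "x \<in> b ` {..<k}"
      then obtain j where "Suc j \<le> k" "x = b j" using Suc_leI by blast
      then show "x \<in> inversions (ws k)"
        using lift_Suc_mono_le[of "\<lambda>k. inversions (ws k)", OF ws(3)] ws(4) by blast
    qed
    then have "card (b ` {..<k}) \<le> card (inversions (ws k))"
      using card_inversions_le[OF set_ws] by (intro card_mono) auto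
    moreover have "card (b ` {..<k}) = k"
      using b by (subst card_image) (auto simp: bij_betw_def intro: inj_on_subset)
    ultimately show ?thesis using ws(1)[of k] by (simp add: filtration_def)
  qed
  have nth: "ws k ! i = s i" if "i < length (ws k)" for k i
  proof (cases "k \<le> Suc i")
    case True
    then show ?thesis using mono[OF True] that by (auto simp: s_def nth_append)
  next
    case False
    then have "Suc i \<le> k" by simp
    then show ?thesis using mono[of "Suc i" k] long[of "Suc i"] by (auto simp: s_def nth_append)
  qed
  have take: "map s [0..<j] = take j (ws k)" if "j \<le> length (ws k)" for j k
    using that by (intro nth_equalityI) (auto simp: nth)
  have "infinite_reduced_word (r ` S) s"
    unfolding infinite_reduced_word_def
  proof (intro conjI allI)
    fix i
    have "i < length (ws (Suc i))" using long[of "Suc i"] by simp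
    then show "s i \<in> r ` S" unfolding s_def using set_ws nth_mem by blast
  next
    fix j
    have "reduced_word (r ` S) (take j (ws j))"
      using reduced[of j] by (metis append_take_drop_id reduced_word_prefix)
    then show "reduced_word (r ` S) (map s [0..<j])" using take[OF long[of j]] by simp
  qed
  moreover have "B = inversion_set_inf P s"
  proof (intro equalityI subsetI)
    fix x assume "x \<in> B"
    then obtain k where "x = b k" using b by (auto simp: bij_betw_def)
    then have "x \<in> inversions (map s [0..<length (ws (Suc k))])"
      using ws(4) by (simp only: take[OF order_refl] take_all order_refl)
    \<comment> \<open>The union in \<open>inversion_set_inf\<close> starts at index 1, so the prefix
      has to be nonempty.\<close>
    moreover have "1 \<le> length (ws (Suc k))" using long[of "Suc k"] by simp
    ultimately show "x \<in> inversion_set_inf P s"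
      unfolding inversion_set_inf_def inversions_def by blast
  next
    fix x assume "x \<in> inversion_set_inf P s"
    then obtain i where "x \<in> inversions (map s [0..<i])"
      unfolding inversion_set_inf_def inversions_def by blast
    \<comment> \<open>The index \<open>i\<close> need not be the length of any \<open>ws k\<close>;
      the prefix clause of \<open>filtration\<close> covers it.\<close>
    then have "x \<in> inversions (take i (ws i))" using take[OF long[of i]] by simp
    then show "x \<in> B" using ws(1)[of i] unfolding filtration_def by blast
  qed
  ultimately show ?thesis by blast
qed

text \<open>A hemispace picks exactly one root from each opposite pair, so its negative roots are
  the negatives of the positive roots that it omits.\<close>

lemma hemispace_disjoint_union:
  assumes F: "hemispace E F"
  shows "is_disjoint_union F (F \<inter> P) (uminus ` (P - F \<inter> P))"
proof -
  note D = hemispaceD[OF F]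
  have "F \<inter> P \<inter> uminus ` (P - F \<inter> P) = {}"
    using not_pos_neg by (auto simp: mem_uminus)
  moreover have "F = F \<inter> P \<union> uminus ` (P - F \<inter> P)"
  proof (intro equalityI subsetI)
    fix x assume "x \<in> F"
    then show "x \<in> F \<inter> P \<union> uminus ` (P - F \<inter> P)"
      using D(1) D(4)[of x] neg_root[of x] by (auto simp: mem_uminus)
  next
    fix x assume "x \<in> F \<inter> P \<union> uminus ` (P - F \<inter> P)"
    then show "x \<in> F"
      using D(5)[of "- x"] roots by (auto simp: mem_uminus)
  qed
  ultimately show ?thesis by (simp add: is_disjoint_union_def)
qed

end

lemma is_disjoint_union_uminus:
  fixes F :: "'b::group_add set"
  assumes "is_disjoint_union F A B"
  shows "is_disjoint_union (uminus ` F) (uminus ` A) (uminus ` B)"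
  using assms by (auto simp: is_disjoint_union_def)

text \<open>Bijectivity is carried through the induction because multiplication in
  \<open>BijGroup UNIV\<close> agrees with composition on bijections.\<close>

lemma word_prod_generate:
  assumes "\<And>f. f \<in> R \<Longrightarrow> bij f" "set xs \<subseteq> R"
  shows "word_prod xs \<in> generate (BijGroup UNIV) R \<and> bij (word_prod xs)"
  using assms(2)
proof (induction xs)
  case Nil
  have "id = \<one>\<^bsub>BijGroup UNIV\<^esub>" by (auto simp: BijGroup_def)
  then have "id \<in> generate (BijGroup UNIV) R" using generate.one by metis
  then show ?case by (simp del: id_apply)
next
  case (Cons f xs)
  then have f: "f \<in> R" "bij f" and xs: "word_prod xs \<in> generate (BijGroup UNIV) R" "bij (word_prod xs)"
    using assms(1) by auto
  have "f \<circ> word_prod xs = f \<otimes>\<^bsub>BijGroup UNIV\<^esub> word_prod xs"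
    using f xs by (auto simp: BijGroup_def Bij_def compose_def)
  moreover have "bij (f \<circ> word_prod xs)" using f xs by (intro bij_comp)
  ultimately show ?case
    using generate.eng[OF generate.incl[OF f(1)] xs(1)] by simp
qed

section \<open>Affine roots\<close>

lemma aff_reflection_involutive:
  assumes "aff_form a a \<noteq> 0"
  shows "aff_reflection a (aff_reflection a v) = v"
  using assms by (simp add: aff_reflection_def aff_form_def inner_diff_left diff_divide_distrib
      algebra_simps)

locale affine_root_basis =
  fixes \<Phi> \<Delta> :: "'a::euclidean_space set" and \<rho> :: 'a
  assumes crys: "crystallographic_root_system \<Phi>"
    and simple: "simple_system \<Phi> \<Delta>"
    and highest: "highest_root \<Phi> \<Delta> \<rho>"
begin

lemma root_nonzero: "\<alpha> \<in> \<Phi> \<Longrightarrow> \<alpha> \<noteq> 0"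
  using crys by (auto simp: crystallographic_root_system_def)

lemma root_line: "\<alpha> \<in> \<Phi> \<Longrightarrow> \<Phi> \<inter> span {\<alpha>} = {\<alpha>, - \<alpha>}"
  using crys by (auto simp: crystallographic_root_system_def)

lemma root_neg: "\<alpha> \<in> \<Phi> \<Longrightarrow> - \<alpha> \<in> \<Phi>"
  using root_line by blast

lemma pos_or_neg: "\<alpha> \<in> \<Phi> \<Longrightarrow> \<alpha> \<in> pos_roots \<Phi> \<Delta> \<or> - \<alpha> \<in> pos_roots \<Phi> \<Delta>"
  using simple root_neg by (auto simp: simple_system_def pos_roots_def)

text \<open>Comparing \<open>\<rho>\<close> with the root \<open>- \<rho>\<close> puts twice
  \<open>\<rho>\<close> into the cone.\<close>

lemma highest_pos: "\<rho> \<in> pos_roots \<Phi> \<Delta>"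
proof -
  have "\<rho> \<in> \<Phi>" using highest by (simp add: highest_root_def)
  then have "\<rho> - (- \<rho>) \<in> nonneg_cone \<Delta>"
    using highest root_neg unfolding highest_root_def by blast
  then have "(1 / 2) *\<^sub>R (\<rho> - (- \<rho>)) \<in> nonneg_cone \<Delta>"
    by (intro nonneg_cone_scale) auto
  also have "(1 / 2) *\<^sub>R (\<rho> - (- \<rho>)) = \<rho>"
    by (simp flip: scaleR_2)
  finally show ?thesis using \<open>\<rho> \<in> \<Phi>\<close> by (simp add: pos_roots_def)
qed

lemma aff_pos_roots_iff:
  "(\<beta>, t) \<in> aff_pos_roots \<Phi> \<Delta> \<longleftrightarrow>
     (\<exists>n::nat. t = real n \<and> \<beta> \<in> pos_roots \<Phi> \<Delta>) \<or>
     (\<exists>n::nat. t = real (Suc n) \<and> - \<beta> \<in> pos_roots \<Phi> \<Delta>)"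
proof -
  have neg: "\<alpha> \<in> uminus ` A \<longleftrightarrow> - \<alpha> \<in> A" for \<alpha> :: 'a and A
    by (metis add.inverse_inverse image_iff)
  show ?thesis
    unfolding aff_pos_roots_def delta_def neg by auto
qed

lemma aff_pos_roots_nat:
  assumes "x \<in> aff_pos_roots \<Phi> \<Delta>"
  obtains \<beta> n where "\<beta> \<in> \<Phi>" "x = (\<beta>, real n)"
proof -
  obtain \<beta> t where x: "x = (\<beta>, t)" by fastforce
  then obtain n where "t = real n" "\<beta> \<in> pos_roots \<Phi> \<Delta> \<or> - \<beta> \<in> pos_roots \<Phi> \<Delta>"
    using assms aff_pos_roots_iff by metis
  moreover from this have "\<beta> \<in> \<Phi>" using root_neg[of "- \<beta>"] by (auto simp: pos_roots_def)
  ultimately show thesis using that x by blast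
qed

text \<open>The strings of positive affine roots and their negatives together fill every integer
  level over each finite root. At level 0 the sign of the finite root decides which half contains
  it.\<close>

lemma aff_roots_iff: "(\<beta>, t) \<in> aff_roots \<Phi> \<Delta> \<longleftrightarrow> \<beta> \<in> \<Phi> \<and> t \<in> \<int>"
proof -
  have neg: "(\<beta>, t) \<in> uminus ` A \<longleftrightarrow> (- \<beta>, - t) \<in> A" for A :: "('a \<times> real) set"
    by (metis (no_types, lifting) add.inverse_inverse image_iff uminus_Pair)
  show ?thesis
  proof
    assume "(\<beta>, t) \<in> aff_roots \<Phi> \<Delta>"
    then consider "(\<beta>, t) \<in> aff_pos_roots \<Phi> \<Delta>" | "(- \<beta>, - t) \<in> aff_pos_roots \<Phi> \<Delta>"
      by (auto simp: aff_roots_def neg)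
    then show "\<beta> \<in> \<Phi> \<and> t \<in> \<int>"
    proof cases
      case 1
      then show ?thesis by (auto elim: aff_pos_roots_nat)
    next
      case 2
      then obtain n :: nat where "- \<beta> \<in> \<Phi>" "- t = real n" by (auto elim: aff_pos_roots_nat)
      then show ?thesis using root_neg[of "- \<beta>"] Ints_of_nat[of n] Ints_minus[of "real n"]
        by (metis minus_minus)
    qed
  next
    assume *: "\<beta> \<in> \<Phi> \<and> t \<in> \<int>"
    then obtain k where k: "t = of_int k" by (auto elim: Ints_cases)
    consider "k > 0" | "k = 0" | "k < 0" by linarith
    then show "(\<beta>, t) \<in> aff_roots \<Phi> \<Delta>"
    proof cases
      case 1
      \<comment> \<open>Both forms of \<open>t\<close> are prepared because the string over a
        positive root starts at level 0 and the one over a negative root at level 1.\<close>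
      then have "t = real (nat k)" "t = real (Suc (nat k - 1))" using k by auto
      then have "(\<beta>, t) \<in> aff_pos_roots \<Phi> \<Delta>"
        using pos_or_neg[of \<beta>] * unfolding aff_pos_roots_iff by blast
      then show ?thesis by (simp add: aff_roots_def)
    next
      case 2
      then have "t = real 0" "- t = real 0" using k by auto
      then have "(\<beta>, t) \<in> aff_pos_roots \<Phi> \<Delta> \<or> (- \<beta>, - t) \<in> aff_pos_roots \<Phi> \<Delta>"
        using pos_or_neg[of \<beta>] * unfolding aff_pos_roots_iff by blast
      then show ?thesis by (auto simp: aff_roots_def neg)
    next
      case 3
      then have "- t = real (nat (- k))" "- t = real (Suc (nat (- k) - 1))" using k by auto
      moreover have "- \<beta> \<in> pos_roots \<Phi> \<Delta> \<or> - (- \<beta>) \<in> pos_roots \<Phi> \<Delta>"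
        using pos_or_neg[of \<beta>] * by auto
      ultimately have "(- \<beta>, - t) \<in> aff_pos_roots \<Phi> \<Delta>"
        unfolding aff_pos_roots_iff by blast
      then show ?thesis by (simp add: aff_roots_def neg)
    qed
  qed
qed

lemma aff_root_cases:
  assumes "a \<in> aff_roots \<Phi> \<Delta>"
  obtains \<alpha> m where "a = (\<alpha>, m)" "\<alpha> \<in> \<Phi>" "m \<in> \<int>" "\<alpha> \<noteq> 0"
  using assms root_nonzero by (cases a) (auto simp: aff_roots_iff)

section \<open>The affine simple roots as a root basis\<close>

lemma aff_simple_roots_pos: "aff_simple_roots \<Delta> \<rho> \<subseteq> aff_pos_roots \<Phi> \<Delta>"
proof -
  have "(\<alpha>, 0) \<in> aff_pos_roots \<Phi> \<Delta>" if "\<alpha> \<in> \<Delta>" for \<alpha>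
    using that simple nonneg_cone_base
    unfolding aff_pos_roots_iff simple_system_def pos_roots_def by (metis IntI of_nat_0 subsetD)
  moreover have "(- \<rho>, 1) \<in> aff_pos_roots \<Phi> \<Delta>"
    unfolding aff_pos_roots_iff using highest_pos by (auto intro!: exI[of _ 0])
  ultimately show ?thesis by (auto simp: aff_simple_roots_def delta_def)
qed

text \<open>First, \<open>delta\<close> is the sum of \<open>(\<rho>, 0)\<close> and
  \<open>delta - (\<rho>, 0)\<close>. Second, for a negative root \<open>\<beta>\<close>,
  \<open>(\<beta>, 1)\<close> is the sum of \<open>(\<rho> + \<beta>, 0)\<close> and
  \<open>delta - (\<rho>, 0)\<close>, where \<open>\<rho> + \<beta>\<close> is in the finite cone
  because \<open>\<rho>\<close> is highest. Higher levels add multiples of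
  \<open>delta\<close>.\<close>

lemma aff_pos_roots_cone: "aff_pos_roots \<Phi> \<Delta> \<subseteq> nonneg_cone (aff_simple_roots \<Delta> \<rho>)"
proof -
  let ?C = "nonneg_cone (aff_simple_roots \<Delta> \<rho>)"
  have fin: "(v, 0) \<in> ?C" if "v \<in> nonneg_cone \<Delta>" for v
  proof -
    have "linear (\<lambda>v::'a. (v, 0::real))" by (simp add: linear_iff)
    from nonneg_cone_linear_image[OF this that] show ?thesis
      by (rule nonneg_cone_least) (auto simp: aff_simple_roots_def intro: nonneg_cone_base)
  qed
  have aff: "(- \<rho>, 1) \<in> ?C"
    by (rule nonneg_cone_base) (simp add: aff_simple_roots_def delta_def)
  have "(\<rho>, 0) + (- \<rho>, 1) \<in> ?C"
    using highest_pos by (intro nonneg_cone_add fin aff) (simp add: pos_roots_def)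
  then have "(0, 1) \<in> ?C" by simp
  then have string: "(v, t) + (0, real n) \<in> ?C" if "(v, t) \<in> ?C" for v t n
    using nonneg_cone_add[OF that nonneg_cone_scale[of "(0, 1)" _ "real n"]] by simp
  show ?thesis
  proof
    fix x assume x: "x \<in> aff_pos_roots \<Phi> \<Delta>"
    obtain \<beta> t where xt: "x = (\<beta>, t)" by fastforce
    from x consider n :: nat where "t = real n" "\<beta> \<in> pos_roots \<Phi> \<Delta>"
      | n :: nat where "t = real (Suc n)" "- \<beta> \<in> pos_roots \<Phi> \<Delta>"
      unfolding xt aff_pos_roots_iff by blast
    then show "x \<in> ?C"
    proof cases
      case (1 n)
      then show ?thesis using string[OF fin[of \<beta>], of n] xt by (simp add: pos_roots_def)
    next
      case (2 n)
      then have "\<rho> - (- \<beta>) \<in> nonneg_cone \<Delta>"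
        using highest by (simp only: highest_root_def pos_roots_def Int_iff)
      then have "(\<rho> - (- \<beta>), 0) + (- \<rho>, 1) \<in> ?C" by (rule nonneg_cone_add[OF fin aff])
      then show ?thesis using string[of \<beta> 1 n] xt 2 by (simp add: add.commute)
    qed
  qed
qed

text \<open>The last coordinate is 1 at \<open>delta - (\<rho>, 0)\<close> and 0 on the span of the
  embedded \<open>\<Delta>\<close>.\<close>

lemma aff_simple_roots_independent: "independent (aff_simple_roots \<Delta> \<rho>)"
proof -
  let ?i = "\<lambda>v::'a. (v, 0::real)"
  have lin: "linear ?i" by (simp add: linear_iff)
  have "independent (?i ` \<Delta>)"
    using simple by (intro linear_independent_injective_image[OF lin]) (auto simp: simple_system_def inj_on_def)
  moreover have "(- \<rho>, 1) \<notin> span (?i ` \<Delta>)"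
    by (auto simp: linear_span_image[OF lin])
  ultimately show ?thesis
    by (simp add: aff_simple_roots_def delta_def independent_insert)
qed

lemma aff_root_basis:
  "root_basis (aff_roots \<Phi> \<Delta>) (aff_pos_roots \<Phi> \<Delta>) (aff_simple_roots \<Delta> \<rho>) aff_reflection"
proof (rule root_basis.intro)
  show "aff_roots \<Phi> \<Delta> = aff_pos_roots \<Phi> \<Delta> \<union> uminus ` aff_pos_roots \<Phi> \<Delta>"
    by (rule aff_roots_def)
  show "0 \<notin> aff_roots \<Phi> \<Delta>"
    using root_nonzero by (auto simp: zero_prod_def aff_roots_iff)
  fix a assume "a \<in> aff_simple_roots \<Delta> \<rho>"
  then have "a \<in> aff_roots \<Phi> \<Delta>" using aff_simple_roots_pos by (auto simp: aff_roots_def)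
  then obtain \<alpha> m where a: "a = (\<alpha>, m)" "\<alpha> \<in> \<Phi>" "m \<in> \<int>" "\<alpha> \<noteq> 0" by (rule aff_root_cases)
  have form: "aff_form a a \<noteq> 0" using a by (simp add: aff_form_def)
  show "aff_roots \<Phi> \<Delta> \<inter> span {a} = {a, - a}"
  proof (intro equalityI subsetI)
    fix x assume x: "x \<in> aff_roots \<Phi> \<Delta> \<inter> span {a}"
    then obtain k where k: "x = k *\<^sub>R a" by (auto simp: span_singleton)
    \<comment> \<open>Projection to the finite part reduces the claim to the line through
      \<open>\<alpha>\<close>; since \<open>\<alpha>\<close> is nonzero, the scalar \<open>k\<close>
      can be recovered there.\<close>
    then have "k *\<^sub>R \<alpha> \<in> \<Phi> \<inter> span {\<alpha>}"
      using x a by (auto simp: aff_roots_iff span_singleton)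
    then have "k *\<^sub>R \<alpha> = 1 *\<^sub>R \<alpha> \<or> k *\<^sub>R \<alpha> = (- 1) *\<^sub>R \<alpha>"
      using root_line[OF a(2)] by auto
    then have "k = 1 \<or> k = - 1" using a(4) by (metis scaleR_right_imp_eq)
    then show "x \<in> {a, - a}" using k by auto
  next
    fix x assume "x \<in> {a, - a}"
    then show "x \<in> aff_roots \<Phi> \<Delta> \<inter> span {a}"
      using a root_neg span_base[of a "{a}"] span_neg[of a "{a}"] by (auto simp: aff_roots_iff)
  qed
  show "linear (aff_reflection a)"
    by (simp add: linear_iff aff_reflection_def aff_form_def inner_add_left add_divide_distrib
        algebra_simps)
  show "aff_reflection a a = - a"
    using form by (simp add: aff_reflection_def scaleR_2)
  fix v
  show "aff_reflection a (aff_reflection a v) = v"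
    using form by (rule aff_reflection_involutive)
  show "v - aff_reflection a v \<in> span {a}"
    by (simp add: aff_reflection_def span_scale span_base)
  assume "v \<in> aff_roots \<Phi> \<Delta>"
  then obtain \<beta> t where v: "v = (\<beta>, t)" "\<beta> \<in> \<Phi>" "t \<in> \<int>" by (rule aff_root_cases)
  \<comment> \<open>This Cartan integer governs both coordinates: the finite part is reflected in
    \<open>\<alpha>\<close>, and the level moves by the integer \<open>?c * m\<close>.\<close>
  let ?c = "2 * (\<beta> \<bullet> \<alpha>) / (\<alpha> \<bullet> \<alpha>)"
  have "?c \<in> \<int>" "\<beta> - ?c *\<^sub>R \<alpha> \<in> \<Phi>"
    using crys a v unfolding crystallographic_root_system_def by blast+
  then have "(\<beta> - ?c *\<^sub>R \<alpha>, t - ?c * m) \<in> aff_roots \<Phi> \<Delta>"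
    unfolding aff_roots_iff using a(3) v(3) by (intro conjI Ints_diff Ints_mult)
  then show "aff_reflection a v \<in> aff_roots \<Phi> \<Delta>"
    using a v by (simp add: aff_reflection_def aff_form_def)
qed (use aff_simple_roots_pos aff_pos_roots_cone aff_simple_roots_independent in auto)

sublocale root_basis "aff_roots \<Phi> \<Delta>" "aff_pos_roots \<Phi> \<Delta>" "aff_simple_roots \<Delta> \<rho>" aff_reflection
  by (rule aff_root_basis)

text \<open>In each string the elements of \<open>P - F\<close> lie above the lowest one in direction \<open>\<delta>\<close>, so a
  functional negative on \<open>\<delta>\<close> and on these finitely many lowest elements is negative on \<open>P - F\<close>.\<close>

lemma finite_approximation:
  assumes F: "hemispace (aff_roots \<Phi> \<Delta>) F" and d: "delta \<notin> nonneg_cone F"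
    and G: "finite G" "G \<subseteq> F \<inter> aff_pos_roots \<Phi> \<Delta>"
  shows "\<exists>F'. hemispace (aff_roots \<Phi> \<Delta>) F' \<and> finite (F' \<inter> aff_pos_roots \<Phi> \<Delta>) \<and> G \<subseteq> F' \<and>
    F' \<inter> aff_pos_roots \<Phi> \<Delta> \<subseteq> F \<inter> aff_pos_roots \<Phi> \<Delta>"
proof -
  let ?E = "aff_roots \<Phi> \<Delta>" and ?P = "aff_pos_roots \<Phi> \<Delta>"
  define Q where "Q \<beta> n \<longleftrightarrow> (\<beta>, real n) \<in> ?P - F" for \<beta> n
  define H where "H = (\<lambda>\<beta>. (\<beta>, real (Least (Q \<beta>)))) ` {\<beta> \<in> \<Phi>. \<exists>n. Q \<beta> n}"
  have \<Phi>: "finite \<Phi>" using crys by (simp add: crystallographic_root_system_def)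
  have H: "H \<subseteq> ?P - F"
  proof
    fix x assume "x \<in> H"
    then obtain \<beta> n where "x = (\<beta>, real (Least (Q \<beta>)))" "Q \<beta> n" by (auto simp: H_def)
    then show "x \<in> ?P - F" using LeastI[of "Q \<beta>" n] Q_def by metis
  qed
  have "uminus ` H \<subseteq> F" using H hemispaceD(5)[OF F] roots by blast
  then have A: "finite (G \<union> uminus ` H)" "G \<union> uminus ` H \<subseteq> F"
    using G \<Phi> by (auto simp: H_def)
  obtain p where p: "p \<bullet> delta < 0" "\<And>x. x \<in> G \<union> uminus ` H \<Longrightarrow> 0 < p \<bullet> x"
    using hemispace_separation[OF F d A] by metis
  let ?F' = "{x \<in> ?E. 0 < p \<bullet> x \<or> p \<bullet> x = 0 \<and> x \<in> F}"
  have string: "p \<bullet> (\<beta>, real n) = p \<bullet> (\<beta>, real m) + (real n - real m) * (p \<bullet> delta)" for \<beta> n m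
    by (cases p) (simp add: delta_def algebra_simps)
  have "hemispace ?E ?F'"
    by (rule hemispace_refine[OF F bounded_linear.linear[OF bounded_linear_inner_right]])
  moreover have "G \<subseteq> ?F'" using p(2) G roots by blast
  moreover have "?F' \<inter> ?P \<subseteq> F"
  proof
    fix x assume x: "x \<in> ?F' \<inter> ?P"
    then obtain \<beta> n where xn: "\<beta> \<in> \<Phi>" "x = (\<beta>, real n)" by (blast elim: aff_pos_roots_nat)
    show "x \<in> F"
    proof (rule ccontr)
      assume "x \<notin> F"
      then have Q: "Q \<beta> n" using x xn by (auto simp: Q_def)
      let ?m = "Least (Q \<beta>)"
      have "(\<beta>, real ?m) \<in> H" using Q xn by (auto simp: H_def)
      then have "0 < p \<bullet> (- (\<beta>, real ?m))" by (intro p(2)) blast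
      then have "p \<bullet> (\<beta>, real ?m) < 0" by (simp only: inner_minus_right neg_0_less_iff_less)
      moreover have "?m \<le> n" using Q by (rule Least_le)
      then have "(real n - real ?m) * (p \<bullet> delta) \<le> 0"
        using p(1) by (intro mult_nonneg_nonpos) auto
      ultimately have "p \<bullet> x < 0" unfolding xn string[of \<beta> n ?m] by linarith
      then show False using x by auto
    qed
  qed
  moreover have "finite (?F' \<inter> ?P)"
  proof (rule finite_subset)
    show "finite (\<Union>\<beta>\<in>\<Phi>. (\<lambda>n. (\<beta>, real n)) ` {..nat \<lceil>(p \<bullet> (\<beta>, 0)) / - (p \<bullet> delta)\<rceil>})"
      using \<Phi> by simp
    show "?F' \<inter> ?P \<subseteq> (\<Union>\<beta>\<in>\<Phi>. (\<lambda>n. (\<beta>, real n)) ` {..nat \<lceil>(p \<bullet> (\<beta>, 0)) / - (p \<bullet> delta)\<rceil>})"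
    proof
      fix x assume x: "x \<in> ?F' \<inter> ?P"
      then obtain \<beta> n where xn: "\<beta> \<in> \<Phi>" "x = (\<beta>, real n)" by (blast elim: aff_pos_roots_nat)
      \<comment> \<open>Since \<open>p\<close> decreases along \<open>delta\<close>, nonnegativity
        bounds the level in each string; there are finitely many strings.\<close>
      have "0 \<le> p \<bullet> x" using x by auto
      then have "real n * - (p \<bullet> delta) \<le> p \<bullet> (\<beta>, 0)" using string[of \<beta> n 0] xn by simp
      then have "real n \<le> (p \<bullet> (\<beta>, 0)) / - (p \<bullet> delta)" using p(1) by (subst pos_le_divide_eq) auto
      then have "n \<le> nat \<lceil>(p \<bullet> (\<beta>, 0)) / - (p \<bullet> delta)\<rceil>" by linarith
      then show "x \<in> (\<Union>\<beta>\<in>\<Phi>. (\<lambda>n. (\<beta>, real n)) ` {..nat \<lceil>(p \<bullet> (\<beta>, 0)) / - (p \<bullet> delta)\<rceil>})"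
        using xn by blast
    qed
  qed
  ultimately show ?thesis by (intro exI[of _ ?F']) blast
qed

section \<open>From positive parts of hemispaces to words\<close>

lemma word_prod_aff_weyl_group:
  assumes "set xs \<subseteq> aff_reflection ` aff_simple_roots \<Delta> \<rho>"
  shows "word_prod xs \<in> aff_weyl_group \<Phi> \<Delta>"
proof -
  have "bij (aff_reflection a)" if a: "a \<in> aff_roots \<Phi> \<Delta>" for a
  proof -
    obtain \<alpha> m where "a = (\<alpha>, m)" "\<alpha> \<in> \<Phi>" "m \<in> \<int>" "\<alpha> \<noteq> 0"
      using a by (rule aff_root_cases)
    then have "aff_form a a \<noteq> 0" by (simp add: aff_form_def)
    then have "aff_reflection a \<circ> aff_reflection a = id"
      by (simp add: fun_eq_iff aff_reflection_involutive)
    then show ?thesis by (intro o_bij)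
  qed
  moreover have "set xs \<subseteq> aff_reflection ` aff_roots \<Phi> \<Delta>"
    using assms simple_pos roots by blast
  ultimately show ?thesis
    unfolding aff_weyl_group_def using word_prod_generate by blast
qed

lemma hemispace_pos_part:
  assumes F: "hemispace (aff_roots \<Phi> \<Delta>) F" and d: "delta \<notin> nonneg_cone F"
  defines "N \<equiv> F \<inter> aff_pos_roots \<Phi> \<Delta>"
  shows "(\<exists>w \<in> aff_weyl_group \<Phi> \<Delta>. N = inversion_set (aff_pos_roots \<Phi> \<Delta>) w) \<or>
    (\<exists>s. infinite_reduced_word (aff_simple_reflections \<Delta> \<rho>) s \<and>
         N = inversion_set_inf (aff_pos_roots \<Phi> \<Delta>) s)"
proof (cases "finite N")
  case True
  \<comment> \<open>With a finite positive part, \<open>F\<close> serves as its own approximation,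
    and the empty word is extended until its inversions exhaust \<open>N\<close>.\<close>
  then obtain xs where xs: "filtration N xs" "inversions xs = N"
    using finite_hemispace_extend[OF F _ _ filtration_Nil, of N]
    by (auto simp: N_def inversions_Nil)
  then have "word_prod xs \<in> aff_weyl_group \<Phi> \<Delta>"
    by (intro word_prod_aff_weyl_group) (simp add: filtration_def)
  then show ?thesis using xs by (auto simp: inversions_def)
next
  case False
  have "aff_pos_roots \<Phi> \<Delta> \<subseteq> \<Phi> \<times> range real" by (auto elim: aff_pos_roots_nat)
  moreover have "countable (\<Phi> \<times> range real)"
    using crys by (simp add: crystallographic_root_system_def countable_finite)
  ultimately have "countable N"
    unfolding N_def by (meson countable_subset inf_le2 order_trans)
  then show ?thesis
    using infinite_word[OF False] finite_approximation[OF F d]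
    by (simp add: N_def aff_simple_reflections_def)
qed

end

theorem corollary7p6:
  fixes \<Phi> \<Delta> :: "'a::euclidean_space set" and \<rho> :: 'a and F :: "('a \<times> real) set"
  assumes "crystallographic_root_system \<Phi>"
    and "irreducible_root_system \<Phi>"
    and "simple_system \<Phi> \<Delta>"
    and "highest_root \<Phi> \<Delta> \<rho>"
    and "hemispace (aff_roots \<Phi> \<Delta>) F"
  shows "\<exists>N. ((\<exists>w \<in> aff_weyl_group \<Phi> \<Delta>. N = inversion_set (aff_pos_roots \<Phi> \<Delta>) w) \<or>
              (\<exists>s. infinite_reduced_word (aff_simple_reflections \<Delta> \<rho>) s \<and>
                   N = inversion_set_inf (aff_pos_roots \<Phi> \<Delta>) s)) \<and>
             (is_disjoint_union F N (uminus ` (aff_pos_roots \<Phi> \<Delta> - N)) \<or>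
              is_disjoint_union F (uminus ` N) (aff_pos_roots \<Phi> \<Delta> - N))"
proof -
  interpret affine_root_basis \<Phi> \<Delta> \<rho>
    using assms by unfold_locales
  note F = assms(5)
  show ?thesis
  proof (cases "delta \<in> nonneg_cone F")
    case False
    show ?thesis
      using hemispace_pos_part[OF F False] hemispace_disjoint_union[OF F] by blast
  next
    case True
    let ?F = "uminus ` F"
    have F': "hemispace (aff_roots \<Phi> \<Delta>) ?F" by (rule hemispace_uminus[OF F])
    \<comment> \<open>Otherwise \<open>delta\<close> and its negative would both lie in the cone of
      \<open>F\<close>, forcing \<open>delta\<close> to be 0.\<close>
    have "delta \<notin> nonneg_cone ?F"
      using hemispace_pointed[OF F True] by (auto simp: nonneg_cone_uminus delta_def zero_prod_def)
    note hemispace_pos_part[OF F' this]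
    \<comment> \<open>Here \<open>N\<close> is the positive part of the negated hemispace; negating
      that hemispace's decomposition yields the second form for \<open>F\<close>.\<close>
    moreover have "is_disjoint_union F (uminus ` (?F \<inter> aff_pos_roots \<Phi> \<Delta>))
        (aff_pos_roots \<Phi> \<Delta> - ?F \<inter> aff_pos_roots \<Phi> \<Delta>)"
      using is_disjoint_union_uminus[OF hemispace_disjoint_union[OF F']]
      by (simp add: image_image)
    ultimately show ?thesis by blast
  qed
qed

end
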